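(* Let $K\subset\mathbb{R}^3$ be a closed convex body whose boundary is parametrized by a twice differentiable regular parametrization $\boldsymbol\sigma(u,v)$ with unit normal $\mathbf{n}$ pointing into $K$, and let $c(t)$ be a differentiable trajectory in $\Omega=\mathbb{R}^3\setminus K$. Write $c(t)=\boldsymbol\sigma(u(t),v(t))-r(t)\,\mathbf{n}(u(t),v(t))$, where $r(t)>0$ is the distance from $c(t)$ to $K$ and $\boldsymbol\sigma(u(t),v(t))$ is the point of $K$ nearest to $c(t)$. Let $I$ be the $2\times2$ identity matrix. Then $u,v,r$ are differentiable in $t$, $I-rW$ is invertible, and $$\begin{pmatrix}\dot u\\ \dot v\\ \dot r\end{pmatrix}=\begin{pmatrix}(I-rW)^{-1}&0\\ 0&-1\end{pmatrix}\,\Sigma^{-1}\,\dot c ,$$ where $W=W(u(t),v(t))$ and $\Sigma=\Sigma(u(t),v(t))$ are the Weingarten matrix and frame matrix of $\boldsymbol\sigma$, and the $3\times 3$ matrix displayed is block diagonal.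
   Context: A closed convex body is a closed convex set with nonempty interior. $\boldsymbol\sigma:U\to\partial K$, with $U\subset\mathbb{R}^2$ open, is a parametrization of the surface $\partial K$ with $\boldsymbol\sigma_u=\partial_u\boldsymbol\sigma$ and $\boldsymbol\sigma_v=\partial_v\boldsymbol\sigma$ linearly independent at every point (regular), oriented so that the unit normal $\mathbf{n}=\dfrac{\boldsymbol\sigma_u\times\boldsymbol\sigma_v}{|\boldsymbol\sigma_u\times\boldsymbol\sigma_v|}$ points into $K$. The coordinates $u(t),v(t)$ of the nearest point are chosen continuous in $t$. $\Sigma(u,v)$ is the (invertible) $3\times3$ matrix with columns $\boldsymbol\sigma_u,\boldsymbol\sigma_v,\mathbf{n}$, in this order. The Weingarten matrix $W=\begin{pmatrix}w_{11}&w_{12}\\ w_{21}&w_{22}\end{pmatrix}$ at $(u,v)$ is defined by $\mathbf{n}_u=w_{11}\boldsymbol\sigma_u+w_{21}\boldsymbol\sigma_v$ and $\mathbf{n}_v=w_{12}\boldsymbol\sigma_u+w_{22}\boldsymbol\sigma_v$, where $\mathbf{n}_u=\partial_u\mathbf{n}$, $\mathbf{n}_v=\partial_v\mathbf{n}$. A dot denotes the derivative with respect to $t$. *)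

theory Defs
  imports "HOL-Analysis.Analysis"
begin

definition partial_u :: "(real \<times> real \<Rightarrow> real ^ 3) \<Rightarrow> real \<times> real \<Rightarrow> real ^ 3" where
  "partial_u f p = vector_derivative (\<lambda>x. f (x, snd p)) (at (fst p))"

definition partial_v :: "(real \<times> real \<Rightarrow> real ^ 3) \<Rightarrow> real \<times> real \<Rightarrow> real ^ 3" where
  "partial_v f p = vector_derivative (\<lambda>y. f (fst p, y)) (at (snd p))"

definition unit_normal :: "(real \<times> real \<Rightarrow> real ^ 3) \<Rightarrow> real \<times> real \<Rightarrow> real ^ 3" where
  "unit_normal \<sigma> p =
     cross3 (partial_u \<sigma> p) (partial_v \<sigma> p) /\<^sub>R norm (cross3 (partial_u \<sigma> p) (partial_v \<sigma> p))"

text \<open>Differentiability is in the sense of Frechet. As \<open>U\<close> will be open, it amounts to the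
  existence at every point of \<open>U\<close> of the second Frechet derivative; that derivative need not be
  continuous.\<close>

definition twice_differentiable_on :: "(real \<times> real \<Rightarrow> real ^ 3) \<Rightarrow> (real \<times> real) set \<Rightarrow> bool"
    (infix "twice'_differentiable'_on" 50) where
  "\<sigma> twice_differentiable_on U \<longleftrightarrow>
     \<sigma> differentiable_on U \<and> partial_u \<sigma> differentiable_on U \<and> partial_v \<sigma> differentiable_on U"

text \<open>Linear independence is that of the pair of vectors: \<^const>\<open>independent\<close> applied to the set
  of the two would not exclude that they are equal. The map need not be injective or onto the
  boundary, so that a local chart of the boundary is allowed.\<close>

definition regular_parametrization ::
    "(real \<times> real \<Rightarrow> real ^ 3) \<Rightarrow> (real \<times> real) set \<Rightarrow> (real ^ 3) set \<Rightarrow> bool" where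
  "regular_parametrization \<sigma> U S \<longleftrightarrow>
     open U \<and> \<sigma> ` U \<subseteq> S \<and> \<sigma> twice_differentiable_on U \<and>
     (\<forall>p\<in>U. \<forall>a b. a *\<^sub>R partial_u \<sigma> p + b *\<^sub>R partial_v \<sigma> p = 0 \<longrightarrow> a = 0 \<and> b = 0)"

definition points_into :: "real ^ 3 \<Rightarrow> real ^ 3 \<Rightarrow> (real ^ 3) set \<Rightarrow> bool" where
  "points_into d x K \<longleftrightarrow> (\<exists>\<epsilon>>0. \<forall>s\<in>{0<..<\<epsilon>}. x + s *\<^sub>R d \<in> K)"

text \<open>\<^const>\<open>vector\<close> lists the rows of a matrix, hence the transposition.\<close>

definition frame_matrix :: "(real \<times> real \<Rightarrow> real ^ 3) \<Rightarrow> real \<times> real \<Rightarrow> real ^ 3 ^ 3" where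
  "frame_matrix \<sigma> p = transpose (vector [partial_u \<sigma> p, partial_v \<sigma> p, unit_normal \<sigma> p])"

definition weingarten_matrix :: "(real \<times> real \<Rightarrow> real ^ 3) \<Rightarrow> real \<times> real \<Rightarrow> real ^ 2 ^ 2" where
  "weingarten_matrix \<sigma> p = (THE W.
     partial_u (unit_normal \<sigma>) p = W $ 1 $ 1 *\<^sub>R partial_u \<sigma> p + W $ 2 $ 1 *\<^sub>R partial_v \<sigma> p \<and>
     partial_v (unit_normal \<sigma>) p = W $ 1 $ 2 *\<^sub>R partial_u \<sigma> p + W $ 2 $ 2 *\<^sub>R partial_v \<sigma> p)"

definition block_diag :: "real ^ 2 ^ 2 \<Rightarrow> real \<Rightarrow> real ^ 3 ^ 3" where
  "block_diag A d = vector [vector [A $ 1 $ 1, A $ 1 $ 2, 0],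
                            vector [A $ 2 $ 1, A $ 2 $ 2, 0],
                            vector [0, 0, d]]"

end

theory Submission
  imports Defs
begin

text \<open>
  Put \<open>F (p, s) = \<sigma> p - s *\<^sub>R n p\<close> with \<open>n\<close> the unit normal. The hypothesis says that
  \<open>c = F \<circ> g\<close> for the continuous curve \<open>g t = ((u t, v t), r t)\<close>. In the frame
  \<open>\<Sigma>\<close> the derivative of \<open>F\<close> is the block matrix with blocks \<open>I - s W\<close> and \<open>- 1\<close>, so the formula
  follows from the chain rule as soon as \<open>g\<close> is known to be differentiable and \<open>I - s W\<close> to be
  invertible.

  The normal is differentiable but need not be of class \<open>C\<^sup>1\<close>, so neither need \<open>F\<close> be, and the
  inverse function theorem does not apply to it. The continuity of \<open>g\<close> takes its place: once \<open>g\<close> is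
  continuous at \<open>t\<close> and \<open>F\<close> is differentiable at the single point \<open>g t\<close>, with an injective
  derivative, differentiability of \<open>F \<circ> g\<close> at \<open>t\<close> passes to \<open>g\<close> (\<open>has_derivative_lift\<close>).

  Invertibility of \<open>I - s W\<close> for \<open>s > 0\<close> is where convexity enters. The tangent plane at \<open>\<sigma> p\<close> supports
  \<open>K\<close>, so \<open>n p \<bullet> (\<sigma> q - \<sigma> p) \<ge> 0\<close> for all \<open>p\<close> and \<open>q\<close> (\<open>unit_normal_supports\<close>). Adding to this
  the inequality with \<open>p\<close> and \<open>q\<close> exchanged gives \<open>(n q - n p) \<bullet> (\<sigma> q - \<sigma> p) \<le> 0\<close>, and to second
  order \<open>dn h \<bullet> d\<sigma> h \<le> 0\<close> for each direction \<open>h\<close> (\<open>has_derivative_dissipative\<close>). A vector \<open>h\<close> in the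
  kernel of \<open>I - s W\<close> satisfies \<open>s *\<^sub>R dn h = d\<sigma> h\<close>; hence \<open>\<parallel>d\<sigma> h\<parallel>\<^sup>2 \<le> 0\<close> and \<open>h = 0\<close> by regularity.
\<close>

section \<open>Lifting differentiability through a map\<close>

text \<open>The linearization error of \<open>G\<close> is a small multiple of the increment of \<open>g\<close>; it can be
  absorbed, so \<open>g\<close> is Lipschitz at \<open>t\<close>, and then the same error is small compared with the increment of the argument.\<close>

lemma has_derivative_lift_id:
  fixes G :: "'b::real_normed_vector \<Rightarrow> 'b" and g :: "'a::real_normed_vector \<Rightarrow> 'b"
  assumes G: "(G has_derivative (\<lambda>x. x)) (at (g t))"
    and g: "continuous (at t within T) g"
    and k: "((\<lambda>s. G (g s)) has_derivative k') (at t within T)"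
  shows "(g has_derivative k') (at t within T)"
  unfolding has_derivative_within_alt
proof (intro conjI allI impI)
  show bl: "bounded_linear k'"
    using k by (rule has_derivative_bounded_linear)
  obtain B where B: "B > 0" "\<And>x. norm (k' x) \<le> norm x * B"
    using bounded_linear.pos_bounded[OF bl] by blast
  fix e :: real assume e: "e > 0"
  \<comment> \<open>\<open>\<eta> \<le> 1/2\<close> is for the absorption; afterwards \<open>\<parallel>g y - g t\<parallel> \<le> 2 (B + 1) \<parallel>y - t\<parallel>\<close>.\<close>
  define \<eta> where "\<eta> = min (1/2) (e / (2 * B + 3))"
  have \<eta>: "\<eta> > 0" "\<eta> \<le> 1/2" "\<eta> * (2 * B + 3) \<le> e"
  proof -
    show "\<eta> > 0" "\<eta> \<le> 1/2"
      using e B(1) unfolding \<eta>_def by (simp, linarith)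
    have "\<eta> \<le> e / (2 * B + 3)"
      by (simp add: \<eta>_def)
    then show "\<eta> * (2 * B + 3) \<le> e"
      using B(1) by (simp add: pos_le_divide_eq)
  qed
  obtain d1 where d1: "d1 > 0"
    and G1: "\<And>y. norm (y - g t) < d1 \<Longrightarrow> norm (G y - G (g t) - (y - g t)) \<le> \<eta> * norm (y - g t)"
    using G[unfolded has_derivative_within_alt] \<eta>(1) by auto
  obtain d2 where d2: "d2 > 0"
    and k2: "\<And>y. y \<in> T \<Longrightarrow> norm (y - t) < d2 \<Longrightarrow>
               norm (G (g y) - G (g t) - k' (y - t)) \<le> \<eta> * norm (y - t)"
    using k[unfolded has_derivative_within_alt] \<eta>(1) by auto
  obtain d3 where d3: "d3 > 0" and g3: "\<And>y. y \<in> T \<Longrightarrow> norm (y - t) < d3 \<Longrightarrow> norm (g y - g t) < d1"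
    using g[unfolded continuous_within_eps_delta] d1 unfolding dist_norm by blast
  show "\<exists>d>0. \<forall>y\<in>T. norm (y - t) < d \<longrightarrow> norm (g y - g t - k' (y - t)) \<le> e * norm (y - t)"
  proof (intro exI[of _ "min d2 d3"] conjI ballI impI)
    fix y assume y: "y \<in> T" "norm (y - t) < min d2 d3"
    let ?x = "norm (g y - g t)" and ?s = "norm (y - t)"
    have a: "norm (G (g y) - G (g t) - (g y - g t)) \<le> \<eta> * ?x"
      using G1 g3 y by auto
    have b: "norm (G (g y) - G (g t) - k' (y - t)) \<le> \<eta> * ?s"
      using k2 y by auto
    have "norm (g y - g t - k' (y - t)) =
        norm ((G (g y) - G (g t) - k' (y - t)) - (G (g y) - G (g t) - (g y - g t)))"
      by (rule arg_cong[where f = norm]) simp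
    also have "\<dots> \<le> \<eta> * ?s + \<eta> * ?x"
      by (intro order_trans[OF norm_triangle_ineq4] add_mono a b)
    finally have c: "norm (g y - g t - k' (y - t)) \<le> \<eta> * ?s + \<eta> * ?x" .
    have "?x \<le> norm (g y - g t - k' (y - t)) + norm (k' (y - t))"
      by norm
    then have "?x \<le> \<eta> * ?s + \<eta> * ?x + B * ?s"
      using c B(2)[of "y - t"] by (simp add: mult.commute)
    moreover have "\<eta> * ?x \<le> 1/2 * ?x" "\<eta> * ?s \<le> 1 * ?s"
      using \<eta> by (intro mult_right_mono; simp)+
    ultimately have "?x \<le> 2 * (B + 1) * ?s"
      by (simp add: algebra_simps)
    then have "\<eta> * ?x \<le> \<eta> * (2 * (B + 1) * ?s)"
      using \<eta>(1) by (intro mult_left_mono) auto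
    with c have "norm (g y - g t - k' (y - t)) \<le> \<eta> * (2 * B + 3) * ?s"
      by (simp add: algebra_simps)
    also have "\<dots> \<le> e * ?s"
      using \<eta>(3) by (intro mult_right_mono) auto
    finally show "norm (g y - g t - k' (y - t)) \<le> e * ?s" .
  qed (use d2 d3 in auto)
qed

text \<open>Composing \<open>F\<close> with a left inverse \<open>L\<close> of its derivative reduces this to the case of the identity.\<close>

lemma has_derivative_lift:
  fixes F :: "'b::real_normed_vector \<Rightarrow> 'c::real_normed_vector" and g :: "'a::real_normed_vector \<Rightarrow> 'b"
  assumes F: "(F has_derivative F') (at (g t))"
    and L: "bounded_linear L" and inverse: "\<And>x. L (F' x) = x"
    and g: "continuous (at t within T) g"
    and c: "((\<lambda>s. F (g s)) has_derivative c') (at t within T)"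
  shows "(g has_derivative (\<lambda>x. L (c' x))) (at t within T)"
proof (rule has_derivative_lift_id[where G = "\<lambda>y. L (F y)"])
  show "((\<lambda>y. L (F y)) has_derivative (\<lambda>x. x)) (at (g t))"
    using bounded_linear.has_derivative[OF L F] by (simp add: inverse)
  show "((\<lambda>s. L (F (g s))) has_derivative (\<lambda>x. L (c' x))) (at t within T)"
    by (rule bounded_linear.has_derivative[OF L c])
qed (rule g)

text \<open>Divide the inequality at \<open>q = p + x *\<^sub>R h\<close> by \<open>x\<^sup>2\<close> and let \<open>x\<close> tend to zero from the right.\<close>

lemma has_derivative_dissipative:
  fixes f g :: "'a::real_normed_vector \<Rightarrow> 'b::real_inner"
  assumes f: "(f has_derivative f') (at p)" and g: "(g has_derivative g') (at p)"
    and U: "open U" "p \<in> U"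
    and le: "\<And>q. q \<in> U \<Longrightarrow> (f q - f p) \<bullet> (g q - g p) \<le> 0"
  shows "f' h \<bullet> g' h \<le> 0"
proof -
  have quotient: "((\<lambda>x. (k (p + x *\<^sub>R h) - k p) /\<^sub>R x) \<longlongrightarrow> k' h) (at_right 0)"
    if "(k has_derivative k') (at p)" for k :: "'a \<Rightarrow> 'b" and k'
  proof -
    interpret k': bounded_linear k'
      using that by (rule has_derivative_bounded_linear)
    have "((\<lambda>x. k (p + x *\<^sub>R h)) has_derivative (\<lambda>x. k' (x *\<^sub>R h))) (at 0)"
      by (rule has_derivative_compose[where f = "\<lambda>x. p + x *\<^sub>R h", simplified])
        (auto intro!: derivative_eq_intros that)
    then have "((\<lambda>x. k (p + x *\<^sub>R h)) has_derivative (\<lambda>x. x *\<^sub>R k' h)) (at_right 0)"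
      unfolding k'.scaleR by (rule has_derivative_at_withinI)
    then have "((\<lambda>x. (k (p + x *\<^sub>R h) - k p - x *\<^sub>R k' h) /\<^sub>R norm x) \<longlongrightarrow> 0) (at_right 0)"
      by (simp add: has_derivative_at_within)
    moreover have "eventually (\<lambda>x. (k (p + x *\<^sub>R h) - k p - x *\<^sub>R k' h) /\<^sub>R norm x =
        (k (p + x *\<^sub>R h) - k p) /\<^sub>R x - k' h) (at_right 0)"
      using eventually_at_right_less[of "0 :: real"]
      by eventually_elim (simp add: scaleR_diff_right)
    ultimately have "((\<lambda>x. (k (p + x *\<^sub>R h) - k p) /\<^sub>R x - k' h) \<longlongrightarrow> 0) (at_right 0)"
      by (rule Lim_transform_eventually)
    then show ?thesis
      by (simp add: LIM_zero_cancel)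
  qed
  have "((\<lambda>x. p + x *\<^sub>R h) \<longlongrightarrow> p + 0 *\<^sub>R h) (at_right 0)"
    by (intro tendsto_intros)
  then have "eventually (\<lambda>x. p + x *\<^sub>R h \<in> U) (at_right 0)"
    using U by (auto dest: topological_tendstoD)
  moreover have "eventually (\<lambda>x. x > 0) (at_right (0::real))"
    by (rule eventually_at_right_less)
  ultimately have "eventually (\<lambda>x. ((f (p + x *\<^sub>R h) - f p) /\<^sub>R x) \<bullet> ((g (p + x *\<^sub>R h) - g p) /\<^sub>R x) \<le> 0)
      (at_right 0)"
    by eventually_elim (use le in \<open>auto simp: mult_le_0_iff\<close>)
  then show ?thesis
    by (intro tendsto_upperbound[OF tendsto_inner[OF quotient[OF f] quotient[OF g]]]) auto
qed

section \<open>Partial derivatives and matrices\<close>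

lemma has_derivative_partials:
  assumes "f differentiable (at p)"
  shows "(f has_derivative (\<lambda>h. fst h *\<^sub>R partial_u f p + snd h *\<^sub>R partial_v f p)) (at p)"
proof -
  obtain f' where f': "(f has_derivative f') (at p)"
    using assms by (auto simp: differentiable_def)
  interpret f': bounded_linear f'
    using f' by (rule has_derivative_bounded_linear)
  have "((\<lambda>x. f (x, snd p)) has_derivative (\<lambda>h. f' (h, 0))) (at (fst p))"
    by (rule has_derivative_compose[where f = "\<lambda>x. (x, snd p)", simplified])
      (auto intro!: derivative_eq_intros f')
  then have "((\<lambda>x. f (x, snd p)) has_vector_derivative f' (1, 0)) (at (fst p))"
    unfolding has_vector_derivative_def f'.scaleR[symmetric] by simp
  then have u: "partial_u f p = f' (1, 0)"
    unfolding partial_u_def by (rule vector_derivative_at)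
  have "((\<lambda>y. f (fst p, y)) has_derivative (\<lambda>h. f' (0, h))) (at (snd p))"
    by (rule has_derivative_compose[where f = "\<lambda>y. (fst p, y)", simplified])
      (auto intro!: derivative_eq_intros f')
  then have "((\<lambda>y. f (fst p, y)) has_vector_derivative f' (0, 1)) (at (snd p))"
    unfolding has_vector_derivative_def f'.scaleR[symmetric] by simp
  then have v: "partial_v f p = f' (0, 1)"
    unfolding partial_v_def by (rule vector_derivative_at)
  have "f' h = fst h *\<^sub>R partial_u f p + snd h *\<^sub>R partial_v f p" for h
    unfolding u v f'.scaleR[symmetric] f'.add[symmetric] by simp
  then show ?thesis
    using has_derivative_eq_rhs[OF f'] by (simp add: fun_eq_iff)
qed

lemma matrix_inv_mult:
  fixes A :: "'a::field ^ 'n ^ 'n"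
  assumes "invertible A"
  shows "A ** matrix_inv A = mat 1" and "matrix_inv A ** A = mat 1"
  using someI_ex[OF assms[unfolded invertible_def]] by (simp_all add: matrix_inv_def)

lemma invertible_if_kernel_trivial:
  fixes A :: "'a::field ^ 'n ^ 'n"
  assumes "\<And>x. A *v x = 0 \<Longrightarrow> x = 0"
  shows "invertible A"
  using assms by (simp add: invertible_left_inverse matrix_left_invertible_ker)

lemma block_diag_mult_vec:
  "block_diag A d *v x =
     vector [(A *v vector [x $ 1, x $ 2]) $ 1, (A *v vector [x $ 1, x $ 2]) $ 2, d * x $ 3]"
  by (simp add: vec_eq_iff forall_3 block_diag_def matrix_vector_mult_def sum_2 sum_3)

lemma block_diag_left_inverse:
  assumes "B ** A = mat 1" and "e * d = 1"
  shows "block_diag B e *v (block_diag A d *v x) = x"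
proof -
  have eta: "vector [y $ 1, y $ 2] = y" for y :: "real ^ 2"
    by (simp add: vec_eq_iff forall_2)
  have "B *v (A *v y) = y" for y
    by (simp add: matrix_vector_mul_assoc assms(1))
  then show ?thesis
    using assms(2) by (simp add: block_diag_mult_vec eta vec_eq_iff forall_3 mult.assoc[symmetric])
qed

lemma frame_matrix_mult_vec:
  "frame_matrix \<sigma> p *v x = x $ 1 *\<^sub>R partial_u \<sigma> p + x $ 2 *\<^sub>R partial_v \<sigma> p + x $ 3 *\<^sub>R unit_normal \<sigma> p"
  by (simp add: vec_eq_iff frame_matrix_def transpose_def matrix_vector_mult_def sum_3 mult.commute)

section \<open>The moving frame of a regular parametrization\<close>

lemma regular_parametrizationD:
  assumes "regular_parametrization \<sigma> U S"
  shows "open U" and "\<And>p. p \<in> U \<Longrightarrow> \<sigma> p \<in> S"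
    and "\<And>p. p \<in> U \<Longrightarrow> \<sigma> differentiable (at p)"
    and "\<And>p. p \<in> U \<Longrightarrow> partial_u \<sigma> differentiable (at p)"
    and "\<And>p. p \<in> U \<Longrightarrow> partial_v \<sigma> differentiable (at p)"
    and "\<And>p a b. p \<in> U \<Longrightarrow> a *\<^sub>R partial_u \<sigma> p + b *\<^sub>R partial_v \<sigma> p = 0 \<Longrightarrow> a = 0 \<and> b = 0"
  using assms unfolding regular_parametrization_def twice_differentiable_on_def
  by (auto simp: differentiable_on_eq_differentiable_at)

lemma cross_partials_nonzero:
  assumes "regular_parametrization \<sigma> U S" "p \<in> U"
  shows "cross3 (partial_u \<sigma> p) (partial_v \<sigma> p) \<noteq> 0"
proof
  note indep = regular_parametrizationD(6)[OF assms]
  assume "cross3 (partial_u \<sigma> p) (partial_v \<sigma> p) = 0"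
  then consider "partial_u \<sigma> p = 0" | "partial_v \<sigma> p = 0" | k where "partial_v \<sigma> p = k *\<^sub>R partial_u \<sigma> p"
    by (auto simp: cross_eq_0 collinear_lemma)
  then show False
  proof cases
    case 1
    then show False using indep[of 1 0] by simp
  next
    case 2
    then show False using indep[of 0 1] by simp
  next
    case (3 k)
    then show False using indep[of k "- 1"] by simp
  qed
qed

lemma unit_normal_orthonormal:
  assumes "regular_parametrization \<sigma> U S" "p \<in> U"
  shows "unit_normal \<sigma> p \<bullet> partial_u \<sigma> p = 0" and "unit_normal \<sigma> p \<bullet> partial_v \<sigma> p = 0"
    and "unit_normal \<sigma> p \<bullet> unit_normal \<sigma> p = 1"
  using cross_partials_nonzero[OF assms]
  by (simp_all add: unit_normal_def dot_cross_self dot_square_norm power2_eq_square)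

lemma unit_normal_differentiable:
  assumes "regular_parametrization \<sigma> U S" "p \<in> U"
  shows "unit_normal \<sigma> differentiable (at p)"
proof -
  interpret cross: bounded_bilinear cross3
    using bilinear_cross bilinear_conv_bounded_bilinear by blast
  obtain a b where ab: "(partial_u \<sigma> has_derivative a) (at p)" "(partial_v \<sigma> has_derivative b) (at p)"
    using regular_parametrizationD(4,5)[OF assms] by (auto simp: differentiable_def)
  have C: "(\<lambda>q. cross3 (partial_u \<sigma> q) (partial_v \<sigma> q)) differentiable (at p)"
    using cross.FDERIV[OF ab] by (auto simp: differentiable_def)
  have "(\<lambda>q. norm (cross3 (partial_u \<sigma> q) (partial_v \<sigma> q))) differentiable (at p)"
    using cross_partials_nonzero[OF assms]
    by (intro differentiable_compose[OF _ C] differentiable_norm_at)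
  then have "(\<lambda>q. cross3 (partial_u \<sigma> q) (partial_v \<sigma> q) /\<^sub>R norm (cross3 (partial_u \<sigma> q) (partial_v \<sigma> q)))
      differentiable (at p)"
    using cross_partials_nonzero[OF assms] by (intro differentiable_scaleR differentiable_inverse C) auto
  then show ?thesis
    by (simp add: unit_normal_def[abs_def])
qed

lemma frame_matrix_invertible:
  assumes "regular_parametrization \<sigma> U S" "p \<in> U"
  shows "invertible (frame_matrix \<sigma> p)"
proof (rule invertible_if_kernel_trivial)
  fix x :: "real ^ 3"
  assume x: "frame_matrix \<sigma> p *v x = 0"
  then have "unit_normal \<sigma> p \<bullet> (frame_matrix \<sigma> p *v x) = 0"
    by simp
  then have "x $ 3 = 0"
    by (simp add: frame_matrix_mult_vec inner_add_right unit_normal_orthonormal[OF assms])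
  moreover from this x have "x $ 1 = 0 \<and> x $ 2 = 0"
    using regular_parametrizationD(6)[OF assms] by (simp add: frame_matrix_mult_vec)
  ultimately show "x = 0"
    by (simp add: vec_eq_iff forall_3)
qed

lemma tangent_coordinates:
  assumes "regular_parametrization \<sigma> U S" "p \<in> U" "unit_normal \<sigma> p \<bullet> w = 0"
  obtains a b where "w = a *\<^sub>R partial_u \<sigma> p + b *\<^sub>R partial_v \<sigma> p"
proof -
  define x where "x = matrix_inv (frame_matrix \<sigma> p) *v w"
  have w: "w = x $ 1 *\<^sub>R partial_u \<sigma> p + x $ 2 *\<^sub>R partial_v \<sigma> p + x $ 3 *\<^sub>R unit_normal \<sigma> p"
    unfolding frame_matrix_mult_vec[symmetric] x_def matrix_vector_mul_assoc
    by (simp add: matrix_inv_mult frame_matrix_invertible[OF assms(1,2)])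
  then have "unit_normal \<sigma> p \<bullet> w = x $ 3"
    by (simp add: inner_add_right unit_normal_orthonormal[OF assms(1,2)])
  with assms(3) w that show thesis
    by simp
qed

text \<open>The normal has constant length, so its derivative is tangent to the surface.\<close>

lemma unit_normal_derivative_tangent:
  assumes reg: "regular_parametrization \<sigma> U S" and p: "p \<in> U"
    and n': "(unit_normal \<sigma> has_derivative n') (at p)"
  shows "unit_normal \<sigma> p \<bullet> n' h = 0"
proof -
  have "((\<lambda>q. unit_normal \<sigma> q \<bullet> unit_normal \<sigma> q) has_derivative
      (\<lambda>h. unit_normal \<sigma> p \<bullet> n' h + n' h \<bullet> unit_normal \<sigma> p)) (at p)"
    by (intro has_derivative_inner n')
  then have "((\<lambda>q. 1) has_derivative (\<lambda>h. unit_normal \<sigma> p \<bullet> n' h + n' h \<bullet> unit_normal \<sigma> p)) (at p)"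
    by (rule has_derivative_transform_within_open[OF _ regular_parametrizationD(1)[OF reg] p])
      (rule unit_normal_orthonormal(3)[OF reg])
  then have "(\<lambda>h. unit_normal \<sigma> p \<bullet> n' h + n' h \<bullet> unit_normal \<sigma> p) = (\<lambda>h. 0)"
    by (rule has_derivative_unique[OF _ has_derivative_const])
  then have "unit_normal \<sigma> p \<bullet> n' h + n' h \<bullet> unit_normal \<sigma> p = 0"
    by meson
  then show ?thesis
    by (simp add: inner_commute)
qed

text \<open>The definite description in the definition of the Weingarten matrix denotes: the partial
  derivatives of the normal are tangent, and coordinates in the tangent plane are unique.\<close>

lemma weingarten_matrix_equations:
  assumes reg: "regular_parametrization \<sigma> U S" and p: "p \<in> U"
  defines "W \<equiv> weingarten_matrix \<sigma> p"
  shows "partial_u (unit_normal \<sigma>) p = W $ 1 $ 1 *\<^sub>R partial_u \<sigma> p + W $ 2 $ 1 *\<^sub>R partial_v \<sigma> p \<and>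
     partial_v (unit_normal \<sigma>) p = W $ 1 $ 2 *\<^sub>R partial_u \<sigma> p + W $ 2 $ 2 *\<^sub>R partial_v \<sigma> p"
  unfolding W_def weingarten_matrix_def
proof (rule theI')
  let ?a = "partial_u \<sigma> p" and ?b = "partial_v \<sigma> p"
  note n' = has_derivative_partials[OF unit_normal_differentiable[OF reg p]]
  have "unit_normal \<sigma> p \<bullet> partial_u (unit_normal \<sigma>) p = 0" "unit_normal \<sigma> p \<bullet> partial_v (unit_normal \<sigma>) p = 0"
    using unit_normal_derivative_tangent[OF reg p n', of "(1, 0)"]
      unit_normal_derivative_tangent[OF reg p n', of "(0, 1)"] by simp_all
  then obtain a b c d where abcd: "partial_u (unit_normal \<sigma>) p = a *\<^sub>R ?a + b *\<^sub>R ?b"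
      "partial_v (unit_normal \<sigma>) p = c *\<^sub>R ?a + d *\<^sub>R ?b"
    by (metis tangent_coordinates[OF reg p])
  have unique: "x = x' \<and> y = y'" if "x *\<^sub>R ?a + y *\<^sub>R ?b = x' *\<^sub>R ?a + y' *\<^sub>R ?b" for x x' y y'
  proof -
    have "(x - x') *\<^sub>R ?a + (y - y') *\<^sub>R ?b = 0"
      using that by (simp add: algebra_simps)
    then show ?thesis
      using regular_parametrizationD(6)[OF reg p] by fastforce
  qed
  show "\<exists>!W :: real ^ 2 ^ 2. partial_u (unit_normal \<sigma>) p = W $ 1 $ 1 *\<^sub>R ?a + W $ 2 $ 1 *\<^sub>R ?b \<and>
     partial_v (unit_normal \<sigma>) p = W $ 1 $ 2 *\<^sub>R ?a + W $ 2 $ 2 *\<^sub>R ?b"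
  proof (rule ex1I)
    show "partial_u (unit_normal \<sigma>) p = (vector [vector [a, c], vector [b, d]] :: real ^ 2 ^ 2) $ 1 $ 1 *\<^sub>R ?a
          + (vector [vector [a, c], vector [b, d]] :: real ^ 2 ^ 2) $ 2 $ 1 *\<^sub>R ?b \<and>
        partial_v (unit_normal \<sigma>) p = (vector [vector [a, c], vector [b, d]] :: real ^ 2 ^ 2) $ 1 $ 2 *\<^sub>R ?a
          + (vector [vector [a, c], vector [b, d]] :: real ^ 2 ^ 2) $ 2 $ 2 *\<^sub>R ?b"
      by (simp add: abcd)
  next
    fix W :: "real ^ 2 ^ 2"
    assume W: "partial_u (unit_normal \<sigma>) p = W $ 1 $ 1 *\<^sub>R ?a + W $ 2 $ 1 *\<^sub>R ?b \<and>
      partial_v (unit_normal \<sigma>) p = W $ 1 $ 2 *\<^sub>R ?a + W $ 2 $ 2 *\<^sub>R ?b"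
    then have "a = W $ 1 $ 1 \<and> b = W $ 2 $ 1" "c = W $ 1 $ 2 \<and> d = W $ 2 $ 2"
      unfolding abcd by (blast dest: unique)+
    then show "W = vector [vector [a, c], vector [b, d]]"
      by (simp add: vec_eq_iff forall_2)
  qed
qed

lemma unit_normal_has_derivative:
  assumes reg: "regular_parametrization \<sigma> U S" and p: "p \<in> U"
  shows "(unit_normal \<sigma> has_derivative
      (\<lambda>h. (weingarten_matrix \<sigma> p *v vector [fst h, snd h]) $ 1 *\<^sub>R partial_u \<sigma> p
         + (weingarten_matrix \<sigma> p *v vector [fst h, snd h]) $ 2 *\<^sub>R partial_v \<sigma> p)) (at p)"
  using has_derivative_partials[OF unit_normal_differentiable[OF reg p]]
  unfolding weingarten_matrix_equations[OF reg p, THEN conjunct1]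
    weingarten_matrix_equations[OF reg p, THEN conjunct2]
  by (rule has_derivative_eq_rhs)
    (simp add: fun_eq_iff matrix_vector_mult_def sum_2 algebra_simps)

section \<open>Convexity\<close>

text \<open>Some hyperplane supports \<open>K\<close> at \<open>\<sigma> p\<close>. The surface lies on one side of it and touches it at
  \<open>\<sigma> p\<close>, so its normal \<open>m\<close> is orthogonal to both partial derivatives and is a multiple of the
  unit normal; the multiple is positive because the unit normal points into \<open>K\<close>.\<close>

lemma unit_normal_supports:
  assumes K: "closed K" "convex K" "interior K \<noteq> {}"
    and reg: "regular_parametrization \<sigma> U (frontier K)"
    and p: "p \<in> U" and inward: "points_into (unit_normal \<sigma> p) (\<sigma> p) K"
    and y: "y \<in> K"
  shows "unit_normal \<sigma> p \<bullet> (y - \<sigma> p) \<ge> 0"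
proof -
  let ?n = "unit_normal \<sigma> p"
  note reg' = regular_parametrizationD[OF reg]
  have in_K: "\<sigma> q \<in> K" if "q \<in> U" for q
    using reg'(2)[OF that] K(1) by (auto simp: frontier_def)
  have "\<sigma> p \<notin> rel_interior K"
    using reg'(2)[OF p] K(3) by (simp add: frontier_def rel_interior_nonempty_interior)
  then obtain m where "m \<noteq> 0" and supp: "\<And>y. y \<in> K \<Longrightarrow> m \<bullet> \<sigma> p \<le> m \<bullet> y"
    by (rule supporting_hyperplane_rel_boundary[OF K(2) in_K[OF p]]) (rule that; blast)
  have "((\<lambda>q. m \<bullet> \<sigma> q) has_derivative
      (\<lambda>h. m \<bullet> (fst h *\<^sub>R partial_u \<sigma> p + snd h *\<^sub>R partial_v \<sigma> p))) (at p)"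
    by (intro has_derivative_inner_right has_derivative_partials reg'(3) p)
  then have "(\<lambda>h. m \<bullet> (fst h *\<^sub>R partial_u \<sigma> p + snd h *\<^sub>R partial_v \<sigma> p)) = (\<lambda>h. 0)"
    by (rule differential_zero_maxmin[OF p reg'(1)]) (use supp in_K in auto)
  then have z: "m \<bullet> (fst h *\<^sub>R partial_u \<sigma> p + snd h *\<^sub>R partial_v \<sigma> p) = 0" for h
    by meson
  have mu: "m \<bullet> partial_u \<sigma> p = 0" and mv: "m \<bullet> partial_v \<sigma> p = 0"
    using z[of "(1, 0)"] z[of "(0, 1)"] by simp_all
  define l where "l = m \<bullet> ?n"
  have "?n \<bullet> (m - l *\<^sub>R ?n) = 0"
    by (simp add: inner_diff_right unit_normal_orthonormal(3)[OF reg p] l_def inner_commute)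
  then obtain a b where ab: "m - l *\<^sub>R ?n = a *\<^sub>R partial_u \<sigma> p + b *\<^sub>R partial_v \<sigma> p"
    by (rule tangent_coordinates[OF reg p])
  have "(m - l *\<^sub>R ?n) \<bullet> (m - l *\<^sub>R ?n) = 0"
    by (subst (2) ab) (simp add: inner_add_right inner_diff_left mu mv unit_normal_orthonormal[OF reg p])
  then have m: "m = l *\<^sub>R ?n"
    by simp
  have m_inner: "m \<bullet> z = l * (?n \<bullet> z)" for z
    by (subst m) (rule inner_scaleR_left)
  obtain \<epsilon> where "\<epsilon> > 0" and eps: "\<And>s. 0 < s \<Longrightarrow> s < \<epsilon> \<Longrightarrow> \<sigma> p + s *\<^sub>R ?n \<in> K"
    using inward by (auto simp: points_into_def)
  then have "m \<bullet> \<sigma> p \<le> m \<bullet> (\<sigma> p + (\<epsilon> / 2) *\<^sub>R ?n)"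
    by (intro supp) simp
  then have "0 \<le> \<epsilon> / 2 * l"
    by (simp add: inner_add_right l_def)
  with \<open>\<epsilon> > 0\<close> have "l \<ge> 0"
    by (simp add: zero_le_mult_iff)
  moreover have "l \<noteq> 0"
    using \<open>m \<noteq> 0\<close> m by (metis scaleR_zero_left)
  ultimately have "l > 0"
    by simp
  moreover have "0 \<le> l * (?n \<bullet> (y - \<sigma> p))"
    using supp[OF y] by (simp add: m_inner inner_diff_right right_diff_distrib)
  ultimately show ?thesis
    by (simp add: zero_le_mult_iff)
qed

lemma weingarten_offset_invertible:
  assumes K: "closed K" "convex K" "interior K \<noteq> {}"
    and reg: "regular_parametrization \<sigma> U (frontier K)"
    and inward: "\<And>p. p \<in> U \<Longrightarrow> points_into (unit_normal \<sigma> p) (\<sigma> p) K"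
    and p: "p \<in> U" and s: "s > 0"
  shows "invertible (mat 1 - s *\<^sub>R weingarten_matrix \<sigma> p)"
proof (rule invertible_if_kernel_trivial)
  let ?W = "weingarten_matrix \<sigma> p"
  fix x :: "real ^ 2"
  assume "(mat 1 - s *\<^sub>R ?W) *v x = 0"
  then have x: "x = s *\<^sub>R (?W *v x)"
    by (simp add: matrix_vector_mult_diff_rdistrib scaleR_matrix_vector_assoc[symmetric])
  \<comment> \<open>The images of \<open>x\<close> under the derivatives of \<open>\<sigma>\<close> and of the unit normal.\<close>
  define X where "X = x $ 1 *\<^sub>R partial_u \<sigma> p + x $ 2 *\<^sub>R partial_v \<sigma> p"
  define Y where "Y = (?W *v x) $ 1 *\<^sub>R partial_u \<sigma> p + (?W *v x) $ 2 *\<^sub>R partial_v \<sigma> p"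
  have X: "X = s *\<^sub>R Y"
    unfolding X_def by (subst (1 2) x) (simp add: Y_def scaleR_add_right)
  have in_K: "\<sigma> q \<in> K" if "q \<in> U" for q
    using regular_parametrizationD(2)[OF reg that] K(1) by (auto simp: frontier_def)
  have "(unit_normal \<sigma> q - unit_normal \<sigma> p) \<bullet> (\<sigma> q - \<sigma> p) \<le> 0" if "q \<in> U" for q
    using unit_normal_supports[OF K reg p inward[OF p] in_K[OF that]]
      unit_normal_supports[OF K reg that inward[OF that] in_K[OF p]]
    by (simp add: inner_diff_left inner_diff_right)
  from has_derivative_dissipative[OF unit_normal_has_derivative[OF reg p]
      has_derivative_partials[OF regular_parametrizationD(3)[OF reg p]]
      regular_parametrizationD(1)[OF reg] p this, of "(x $ 1, x $ 2)"]
  have "Y \<bullet> X \<le> 0"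
    unfolding X_def Y_def using vec_eq_iff[of "vector [x $ 1, x $ 2]" x] by (simp add: forall_2)
  then have "Y \<bullet> Y \<le> 0"
    using s by (simp add: X mult_le_0_iff)
  then have "Y = 0"
    by (metis inner_eq_zero_iff inner_ge_zero order_antisym)
  then show "x = 0"
    using regular_parametrizationD(6)[OF reg p, of "x $ 1" "x $ 2"] X
    by (simp add: X_def vec_eq_iff forall_2)
qed

section \<open>The equation of motion\<close>

lemma normal_offset_has_derivative:
  assumes reg: "regular_parametrization \<sigma> U S" and p: "p \<in> U"
  shows "((\<lambda>z. \<sigma> (fst z) - snd z *\<^sub>R unit_normal \<sigma> (fst z)) has_derivative
    (\<lambda>z. frame_matrix \<sigma> p *v (block_diag (mat 1 - s *\<^sub>R weingarten_matrix \<sigma> p) (- 1)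
        *v vector [fst (fst z), snd (fst z), snd z]))) (at (p, s))"
proof -
  have fst: "(fst has_derivative fst) (at (p, s))" and snd: "(snd has_derivative snd) (at (p, s))"
    by (auto intro!: derivative_eq_intros)
  note d\<sigma> = has_derivative_compose[OF fst, unfolded fst_conv,
      OF has_derivative_partials[OF regular_parametrizationD(3)[OF reg p]]]
  note dn = has_derivative_compose[OF fst, unfolded fst_conv, OF unit_normal_has_derivative[OF reg p]]
  have "((\<lambda>z. \<sigma> (fst z) - snd z *\<^sub>R unit_normal \<sigma> (fst z)) has_derivative
    (\<lambda>z. (fst (fst z) *\<^sub>R partial_u \<sigma> p + snd (fst z) *\<^sub>R partial_v \<sigma> p)
       - (snd (p, s) *\<^sub>R
           ((weingarten_matrix \<sigma> p *v vector [fst (fst z), snd (fst z)]) $ 1 *\<^sub>R partial_u \<sigma> p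
          + (weingarten_matrix \<sigma> p *v vector [fst (fst z), snd (fst z)]) $ 2 *\<^sub>R partial_v \<sigma> p)
         + snd z *\<^sub>R unit_normal \<sigma> (fst (p, s))))) (at (p, s))"
    by (intro has_derivative_diff has_derivative_scaleR snd d\<sigma> dn)
  then show ?thesis
    by (rule has_derivative_eq_rhs)
      (simp add: fun_eq_iff frame_matrix_mult_vec block_diag_mult_vec matrix_vector_mult_diff_rdistrib
        scaleR_matrix_vector_assoc[symmetric] algebra_simps)
qed

theorem theorem2:
  fixes K :: "(real ^ 3) set"
    and \<sigma> :: "real \<times> real \<Rightarrow> real ^ 3" and U :: "(real \<times> real) set"
    and T :: "real set" and c :: "real \<Rightarrow> real ^ 3"
    and u v r :: "real \<Rightarrow> real"
  assumes "closed K" and "convex K" and "interior K \<noteq> {}"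
    and "regular_parametrization \<sigma> U (frontier K)"
    and "\<And>p. p \<in> U \<Longrightarrow> points_into (unit_normal \<sigma> p) (\<sigma> p) K"
    and "is_interval T" and "interior T \<noteq> {}"
    and "c differentiable_on T"
    and "\<And>t. t \<in> T \<Longrightarrow> c t \<in> - K"
    and "continuous_on T u" and "continuous_on T v"
    and "\<And>t. t \<in> T \<Longrightarrow> (u t, v t) \<in> U"
    and "\<And>t. t \<in> T \<Longrightarrow> \<sigma> (u t, v t) = closest_point K (c t)"
    and "\<And>t. t \<in> T \<Longrightarrow> r t = infdist (c t) K"
    and "\<And>t. t \<in> T \<Longrightarrow> r t > 0"
    and "\<And>t. t \<in> T \<Longrightarrow> c t = \<sigma> (u t, v t) - r t *\<^sub>R unit_normal \<sigma> (u t, v t)"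
  shows "u differentiable_on T \<and> v differentiable_on T \<and> r differentiable_on T \<and>
    (\<forall>t\<in>T.
       invertible (mat 1 - r t *\<^sub>R weingarten_matrix \<sigma> (u t, v t)) \<and>
       (vector [vector_derivative u (at t within T),
                vector_derivative v (at t within T),
                vector_derivative r (at t within T)] :: real ^ 3) =
         (block_diag (matrix_inv (mat 1 - r t *\<^sub>R weingarten_matrix \<sigma> (u t, v t))) (- 1)
            ** matrix_inv (frame_matrix \<sigma> (u t, v t)))
         *v vector_derivative c (at t within T))"
proof -
  note K = assms(1-3) and reg = assms(4) and inward = assms(5)
  note on_chart = assms(12) and c_eq = assms(16)
  let ?D = "\<lambda>t. block_diag (matrix_inv (mat 1 - r t *\<^sub>R weingarten_matrix \<sigma> (u t, v t))) (- 1)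
            ** matrix_inv (frame_matrix \<sigma> (u t, v t))"
  have inv: "invertible (mat 1 - r t *\<^sub>R weingarten_matrix \<sigma> (u t, v t))" if "t \<in> T" for t
    using that by (intro weingarten_offset_invertible[OF K reg inward on_chart] assms(15))
  have "continuous_on T c"
    using assms(8) by (rule differentiable_imp_continuous_on)
  then have "continuous_on T (\<lambda>t. infdist (c t) K)"
    by (rule continuous_on_infdist)
  then have cont_r: "continuous_on T r"
    by (subst continuous_on_cong[OF refl assms(14)])
  have deriv: "(u has_vector_derivative (?D t *v vector_derivative c (at t within T)) $ 1) (at t within T) \<and>
      (v has_vector_derivative (?D t *v vector_derivative c (at t within T)) $ 2) (at t within T) \<and>
      (r has_vector_derivative (?D t *v vector_derivative c (at t within T)) $ 3) (at t within T)"
    if t: "t \<in> T" for t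
  proof -
    define p where "p = (u t, v t)"
    define c' where "c' = vector_derivative c (at t within T)"
    define F where "F = (\<lambda>z. \<sigma> (fst z) - snd z *\<^sub>R unit_normal \<sigma> (fst z))"
    define F' where "F' = (\<lambda>z. frame_matrix \<sigma> p *v (block_diag (mat 1 - r t *\<^sub>R weingarten_matrix \<sigma> p) (- 1)
        *v vector [fst (fst z), snd (fst z), snd z]))"
    define g where "g = (\<lambda>t. ((u t, v t), r t))"
    \<comment> \<open>The left inverse of \<open>F'\<close> is the matrix of the asserted formula, so the derivative \<open>L c'\<close> of \<open>g\<close>
      already has the required form.\<close>
    define L where "L = (\<lambda>w. (((?D t *v w) $ 1, (?D t *v w) $ 2), (?D t *v w) $ 3))"
    have p: "p \<in> U"
      using on_chart[OF t] by (simp add: p_def)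
    have F: "(F has_derivative F') (at (g t))"
      unfolding F_def F'_def g_def p_def[symmetric] by (rule normal_offset_has_derivative[OF reg p])
    have "linear (\<lambda>w. (?D t *v w) $ i)" for i
      by (intro linearI) (simp_all add: matrix_vector_right_distrib matrix_vector_mult_scaleR)
    then have L: "bounded_linear L"
      unfolding L_def by (intro bounded_linear_Pair) (simp_all add: linear_conv_bounded_linear)
    have "?D t *v F' z = vector [fst (fst z), snd (fst z), snd z]" for z
    proof -
      have "?D t *v F' z = block_diag (matrix_inv (mat 1 - r t *\<^sub>R weingarten_matrix \<sigma> p)) (- 1)
          *v ((matrix_inv (frame_matrix \<sigma> p) ** frame_matrix \<sigma> p)
          *v (block_diag (mat 1 - r t *\<^sub>R weingarten_matrix \<sigma> p) (- 1)
          *v vector [fst (fst z), snd (fst z), snd z]))"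
        by (simp add: F'_def p_def matrix_vector_mul_assoc matrix_mul_assoc)
      also have "\<dots> = vector [fst (fst z), snd (fst z), snd z]"
        using inv[OF t] unfolding p_def[symmetric]
        by (simp add: matrix_inv_mult frame_matrix_invertible[OF reg p] block_diag_left_inverse)
      finally show ?thesis .
    qed
    then have LF': "L (F' z) = z" for z
      by (simp add: L_def prod_eq_iff)
    have "continuous_on T g"
      unfolding g_def by (intro continuous_on_Pair assms(10,11) cont_r)
    then have g: "continuous (at t within T) g"
      using t by (simp add: continuous_on_eq_continuous_within)
    have "(c has_derivative (\<lambda>x. x *\<^sub>R c')) (at t within T)"
      using assms(8) t unfolding c'_def has_vector_derivative_def[symmetric]
      by (simp add: differentiable_on_def vector_derivative_works[symmetric])
    then have "((\<lambda>s. F (g s)) has_derivative (\<lambda>x. x *\<^sub>R c')) (at t within T)"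
      by (rule has_derivative_transform[OF t, rotated]) (simp add: F_def g_def c_eq)
    from has_derivative_lift[OF F L LF' g this]
    have dg: "(g has_derivative (\<lambda>x. x *\<^sub>R L c')) (at t within T)"
      by (simp add: linear_simps(5)[OF L])
    show ?thesis
      using has_derivative_fst[OF has_derivative_fst[OF dg]] has_derivative_snd[OF has_derivative_fst[OF dg]]
        has_derivative_snd[OF dg]
      by (simp add: g_def L_def c'_def has_vector_derivative_def)
  qed
  have "T \<noteq> {x}" for x
    using assms(7) by auto
  then have nontrivial: "at t within T \<noteq> bot" if "t \<in> T" for t
    using connected_imp_perfect[OF is_interval_connected[OF assms(6)] that]
    by (simp add: trivial_limit_within)
  show ?thesis
  proof (intro conjI ballI)
    show "u differentiable_on T" "v differentiable_on T" "r differentiable_on T"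
      using deriv unfolding differentiable_on_def has_vector_derivative_def differentiable_def by blast+
  next
    fix t assume t: "t \<in> T"
    show "invertible (mat 1 - r t *\<^sub>R weingarten_matrix \<sigma> (u t, v t))"
      by (rule inv[OF t])
    have "vector_derivative u (at t within T) = (?D t *v vector_derivative c (at t within T)) $ 1"
      "vector_derivative v (at t within T) = (?D t *v vector_derivative c (at t within T)) $ 2"
      "vector_derivative r (at t within T) = (?D t *v vector_derivative c (at t within T)) $ 3"
      using deriv[OF t] by (auto intro: vector_derivative_within[OF nontrivial[OF t]])
    then show "vector [vector_derivative u (at t within T), vector_derivative v (at t within T),
        vector_derivative r (at t within T)] = ?D t *v vector_derivative c (at t within T)"
      by (simp add: vec_eq_iff forall_3)
  qed
qed

end
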